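(* The map $c\mapsto\lambda(c)$ is a bijection between the set $\mathscr{C}$ of crowns and the set of positive integers coprime to $6$; in particular $$\{\lambda(c):c\in\mathscr{C}\}=\{n\in\mathbb{Z}_{>0}:\gcd(n,6)=1\}.$$
   Context: A nonnegative integer $c$ is a crown if $c\equiv 0$ or $8\pmod{12}$; $\mathscr{C}$ denotes the set of crowns. For a crown $c$, $\lambda(c)=(c+2)/2$. *)

theory Defs
  imports "HOL-Number_Theory.Cong"
begin

definition crown :: "nat \<Rightarrow> bool" where
  "crown c \<longleftrightarrow> [c = 0] (mod 12) \<or> [c = 8] (mod 12)"

definition crowns :: "nat set" where
  "crowns = {c. crown c}"

(* Every crown is even, so on crowns the division is exact: 2 * crown_lambda c = c + 2. *)
definition crown_lambda :: "nat \<Rightarrow> nat" where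
  "crown_lambda c = (c + 2) div 2"

end

theory Submission
  imports Defs
begin

text \<open>
  The affine map \<open>c \<mapsto> (c + 2) / 2\<close> on even numbers has inverse \<open>n \<mapsto> 2 n - 2\<close>, and it turns residues
  modulo 12 into residues modulo 6: \<open>12 k \<mapsto> 6 k + 1\<close> and \<open>12 k + 8 \<mapsto> 6 k + 5\<close>. The two crown classes
  thus correspond exactly to the classes 1 and 5 modulo 6, which are the units modulo 6
  (\<open>coprime_6_iff\<close>).
\<close>

lemma coprime_6_iff:
  fixes n :: nat
  shows "coprime n 6 \<longleftrightarrow> n mod 6 = 1 \<or> n mod 6 = 5"
proof -
  have "gcd 6 r = 1 \<longleftrightarrow> r = 1 \<or> r = 5" if "r < 6" for r :: nat
  proof -
    have "r \<in> {0, 1, 2, 3, 4, 5}" using that by auto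
    then show ?thesis by (auto simp: gcd_non_0_nat)
  qed
  moreover have "coprime n 6 \<longleftrightarrow> gcd 6 (n mod 6) = 1"
    by (simp add: coprime_iff_gcd_eq_1 gcd.commute flip: gcd_red_nat)
  ultimately show ?thesis
    by (metis mod_less_divisor zero_less_numeral)
qed

lemma crown_iff: "crown c \<longleftrightarrow> c mod 12 = 0 \<or> c mod 12 = 8"
  by (simp add: crown_def cong_def)

lemma bij_betw_crown_lambda:
  "bij_betw crown_lambda crowns {n::nat. n > 0 \<and> coprime n 6}"
proof (rule bij_betw_byWitness[where f' = "\<lambda>n. 2 * n - 2"])
  show "\<forall>c\<in>crowns. 2 * crown_lambda c - 2 = c"
    unfolding crowns_def crown_iff crown_lambda_def mem_Collect_eq Ball_def by presburger
  show "\<forall>n\<in>{n. n > 0 \<and> coprime n 6}. crown_lambda (2 * n - 2) = n"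
    by (auto simp: crown_lambda_def)
  show "crown_lambda ` crowns \<subseteq> {n. n > 0 \<and> coprime n 6}"
  proof (rule image_subsetI)
    fix c assume "c \<in> crowns"
    then have "c mod 12 = 0 \<or> c mod 12 = 8"
      by (simp only: crowns_def crown_iff mem_Collect_eq)
    then obtain k where "c = 12 * k \<or> c = 12 * k + 8"
      by (metis add.right_neutral mult_div_mod_eq)
    then have "crown_lambda c = 6 * k + 1 \<or> crown_lambda c = 6 * k + 5"
      by (auto simp: crown_lambda_def)
    then show "crown_lambda c \<in> {n. n > 0 \<and> coprime n 6}"
      by (auto simp: coprime_6_iff)
  qed
  show "(\<lambda>n. 2 * n - 2) ` {n. n > 0 \<and> coprime n 6} \<subseteq> crowns"
  proof (rule image_subsetI)
    fix n :: nat assume "n \<in> {n. n > 0 \<and> coprime n 6}"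
    then have "n mod 6 = 1 \<or> n mod 6 = 5"
      by (simp only: coprime_6_iff mem_Collect_eq)
    then obtain k where "n = 6 * k + 1 \<or> n = 6 * k + 5"
      by (metis mult_div_mod_eq)
    then have "2 * n - 2 = 12 * k \<or> 2 * n - 2 = 12 * k + 8"
      by auto
    then show "2 * n - 2 \<in> crowns"
      by (auto simp: crowns_def crown_iff)
  qed
qed

theorem proposition2p3:
  shows "bij_betw crown_lambda crowns {n::nat. n > 0 \<and> coprime n 6}
       \<and> {crown_lambda c | c. c \<in> crowns} = {n::nat. n > 0 \<and> gcd n 6 = 1}"
proof
  show "bij_betw crown_lambda crowns {n::nat. n > 0 \<and> coprime n 6}"
    by (rule bij_betw_crown_lambda)
  then have "crown_lambda ` crowns = {n. n > 0 \<and> coprime n 6}"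
    by (rule bij_betw_imp_surj_on)
  then show "{crown_lambda c | c. c \<in> crowns} = {n::nat. n > 0 \<and> gcd n 6 = 1}"
    by (simp only: coprime_iff_gcd_eq_1 Setcompr_eq_image Collect_mem_eq)
qed

end
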